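(* For every integer $n\ge 1$, $$Q_n(t)=\frac{1}{t}\big(V_{n,1}+V_{n,2}+\cdots+V_{n,n}\big)\quad\text{and}\quad P_n(t)-t\,Q_n(t)=V_{n,-1}+V_{n,-2}+\cdots+V_{n,-n}.$$
   Context: The polynomials $P_n,Q_n$ ($n\ge 0$) are defined by $\frac{d^n}{dx^n}\tan x=P_n(\tan x)$ and $\frac{d^n}{dx^n}\sec x=Q_n(\tan x)\sec x$. The polynomials $V_{n,k}=V_{n,k}(t)$, for integers $n\ge1$ and $1\le |k|\le n$, are defined by $V_{1,1}=t^2$, $V_{1,-1}=1$, $V_{n,-n}=0$ for $n\ge 2$, and the recurrences $V_{n,-k}=V_{n,-k-1}+t^{-1}V_{n-1,k}$ for $n>k\ge 1$; $V_{n,1}=t^2\,V_{n,-1}$ for $n\ge 2$; $V_{n,k}=V_{n,k-1}+t\,V_{n-1,-k+1}$ for $n\ge k>1$. *)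

theory Defs
  imports "HOL-Analysis.Analysis" "HOL-Computational_Algebra.Polynomial_Factorial"
begin

definition sec :: "real \<Rightarrow> real" where
  "sec x = 1 / cos x"

(* In HOL, tan and sec are total, hence the restriction to the points with cos x \<noteq> 0.
   The lemmas P_poly_tan, P_poly_unique, Q_poly_sec, Q_poly_unique below show that the
   two descriptions are uniquely satisfiable. *)
definition P_poly :: "nat \<Rightarrow> real poly" where
  "P_poly n = (THE p. \<forall>x. cos x \<noteq> 0 \<longrightarrow> (deriv ^^ n) tan x = poly p (tan x))"

definition Q_poly :: "nat \<Rightarrow> real poly" where
  "Q_poly n = (THE q. \<forall>x. cos x \<noteq> 0 \<longrightarrow> (deriv ^^ n) sec x = poly q (tan x) * sec x)"

lemma poly_eq_if_eq_on_tan: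
  fixes p q :: "real poly"
  assumes "\<And>x. cos x \<noteq> 0 \<Longrightarrow> poly p (tan x) = poly q (tan x)"
  shows "p = q"
proof -
  have "poly p y = poly q y" for y
    using assms[of "arctan y"] by (simp add: tan_arctan)
  then show ?thesis
    by (simp add: poly_eq_poly_eq_iff[symmetric] fun_eq_iff)
qed

lemma eventually_cos_neq_0: "eventually (\<lambda>y. cos y \<noteq> 0) (nhds x)"
  if "cos x \<noteq> 0" for x :: real
proof -
  have "open {y::real. cos y \<noteq> 0}"
    by (intro open_Collect_neq continuous_intros)
  with that show ?thesis
    by (auto simp: eventually_nhds)
qed

lemma DERIV_tan_poly: "DERIV tan x :> 1 + (tan x)\<^sup>2" if "cos x \<noteq> 0" for x :: real
  using DERIV_tan[OF that] by (simp add: tan_sec[OF that] power_inverse)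

lemma DERIV_sec: "DERIV sec x :> tan x * sec x" if "cos x \<noteq> 0"
  unfolding sec_def[abs_def]
  by (rule derivative_eq_intros refl that)+ (simp add: tan_def that)

lemma ex_P_poly:
  "\<exists>p::real poly. \<forall>x. cos x \<noteq> 0 \<longrightarrow> (deriv ^^ n) tan x = poly p (tan x)"
proof (induction n)
  case 0
  show ?case by (intro exI[of _ "[:0, 1:]"]) simp
next
  case (Suc n)
  then obtain p :: "real poly"
    where p: "\<And>x. cos x \<noteq> 0 \<Longrightarrow> (deriv ^^ n) tan x = poly p (tan x)" by blast
  have "(deriv ^^ Suc n) tan x = poly (pderiv p * [:1, 0, 1:]) (tan x)" if x: "cos x \<noteq> 0" for x
  proof -
    have "deriv ((deriv ^^ n) tan) x = deriv (\<lambda>y. poly p (tan y)) x"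
      by (intro deriv_cong_ev refl eventually_mono[OF eventually_cos_neq_0[OF x]]) (rule p)
    also have "\<dots> = poly (pderiv p) (tan x) * (1 + (tan x)\<^sup>2)"
      by (intro DERIV_imp_deriv DERIV_chain2[OF poly_DERIV DERIV_tan_poly] x)
    finally show ?thesis by (simp add: power2_eq_square algebra_simps)
  qed
  then show ?case by blast
qed

lemma ex_Q_poly:
  "\<exists>q::real poly. \<forall>x. cos x \<noteq> 0 \<longrightarrow> (deriv ^^ n) sec x = poly q (tan x) * sec x"
proof (induction n)
  case 0
  show ?case by (intro exI[of _ 1]) simp
next
  case (Suc n)
  then obtain q :: "real poly"
    where q: "\<And>x. cos x \<noteq> 0 \<Longrightarrow> (deriv ^^ n) sec x = poly q (tan x) * sec x" by blast
  have "(deriv ^^ Suc n) sec x = poly (pderiv q * [:1, 0, 1:] + [:0, 1:] * q) (tan x) * sec x"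
    if x: "cos x \<noteq> 0" for x
  proof -
    have "deriv ((deriv ^^ n) sec) x = deriv (\<lambda>y. poly q (tan y) * sec y) x"
      by (intro deriv_cong_ev refl eventually_mono[OF eventually_cos_neq_0[OF x]]) (rule q)
    also have "\<dots> = poly (pderiv q) (tan x) * (1 + (tan x)\<^sup>2) * sec x
                     + tan x * sec x * poly q (tan x)"
      by (intro DERIV_imp_deriv DERIV_mult DERIV_chain2[OF poly_DERIV DERIV_tan_poly] DERIV_sec x)
    finally show ?thesis by (simp add: power2_eq_square algebra_simps)
  qed
  then show ?case by blast
qed

lemma P_poly_unique:
  assumes "\<And>x. cos x \<noteq> 0 \<Longrightarrow> (deriv ^^ n) tan x = poly p (tan x)"
  shows "P_poly n = p"
  unfolding P_poly_def
  by (rule the_equality) (use assms in \<open>auto intro!: poly_eq_if_eq_on_tan\<close>)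

lemma P_poly_tan: "cos x \<noteq> 0 \<Longrightarrow> (deriv ^^ n) tan x = poly (P_poly n) (tan x)"
  using ex_P_poly[of n] P_poly_unique by blast

lemma Q_poly_unique:
  assumes "\<And>x. cos x \<noteq> 0 \<Longrightarrow> (deriv ^^ n) sec x = poly q (tan x) * sec x"
  shows "Q_poly n = q"
  unfolding Q_poly_def
proof (rule the_equality)
  show "q' = q" if "\<forall>x. cos x \<noteq> 0 \<longrightarrow> (deriv ^^ n) sec x = poly q' (tan x) * sec x" for q'
  proof (rule poly_eq_if_eq_on_tan)
    fix x :: real
    assume x: "cos x \<noteq> 0"
    then have "poly q' (tan x) * sec x = poly q (tan x) * sec x"
      using that assms by metis
    with x show "poly q' (tan x) = poly q (tan x)" by (simp add: sec_def)
  qed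
qed (use assms in auto)

lemma Q_poly_sec: "cos x \<noteq> 0 \<Longrightarrow> (deriv ^^ n) sec x = poly (Q_poly n) (tan x) * sec x"
  using ex_Q_poly[of n] Q_poly_unique by blast

(* The recurrences divide by t, so the V n k are taken in the field of rational functions
   in t; V_polynomial below shows that they are polynomials. *)
definition t_var :: "real poly fract" where
  "t_var = to_fract [:0, 1:]"

(* Value 0 outside the index range n \<ge> 1, 1 \<le> |k| \<le> n. In the branch k < 0 the recurrence
   for V n (-j), n > j \<ge> 1, is written with k = -j. *)
function V :: "nat \<Rightarrow> int \<Rightarrow> real poly fract" where
  "V n k =
     (if n = 0 \<or> k = 0 \<or> \<bar>k\<bar> > int n then 0
      else if n = 1 then (if k = 1 then t_var\<^sup>2 else 1)
      else if k = - int n then 0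
      else if k < 0 then V n (k - 1) + inverse t_var * V (n - 1) (- k)
      else if k = 1 then t_var\<^sup>2 * V n (- 1)
      else V n (k - 1) + t_var * V (n - 1) (- k + 1))"
  by pat_completeness auto
termination
  by (relation "measures [fst, \<lambda>(n, k). nat (k + int n)]") auto

declare V.simps [simp del]

lemma V_1_1: "V 1 1 = t_var\<^sup>2"
  and V_1_m1: "V 1 (- 1) = 1"
  and V_neg_n: "n \<ge> 2 \<Longrightarrow> V n (- int n) = 0"
  and V_neg: "n > k \<Longrightarrow> k \<ge> 1 \<Longrightarrow>
        V n (- int k) = V n (- int k - 1) + inverse t_var * V (n - 1) (int k)"
  and V_one: "n \<ge> 2 \<Longrightarrow> V n 1 = t_var\<^sup>2 * V n (- 1)"
  and V_pos: "n \<ge> k \<Longrightarrow> k > 1 \<Longrightarrow>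
        V n (int k) = V n (int k - 1) + t_var * V (n - 1) (- int k + 1)"
  by (subst V.simps; force)+

lemma V_polynomial_aux:
  "V n k \<in> range to_fract \<and> (k > 0 \<longrightarrow> inverse t_var * V n k \<in> range to_fract)"
proof (induction n k rule: V.induct)
  case (1 n k)
  have t0: "t_var \<noteq> 0" by (simp add: t_var_def)
  have t_in: "t_var \<in> range to_fract" by (simp add: t_var_def)
  have add: "a + b \<in> range to_fract" if "a \<in> range to_fract" "b \<in> range to_fract"
    for a b :: "real poly fract"
    using that by (auto simp flip: to_fract_add)
  have mult: "a * b \<in> range to_fract" if "a \<in> range to_fract" "b \<in> range to_fract"
    for a b :: "real poly fract"
    using that by (auto simp flip: to_fract_mult)
  have zero: "0 \<in> range (to_fract :: real poly \<Rightarrow> _)"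
    and one: "1 \<in> range (to_fract :: real poly \<Rightarrow> _)"
    by (metis rangeI to_fract_0, metis rangeI to_fract_1)
  consider (out) "n = 0 \<or> k = 0 \<or> \<bar>k\<bar> > int n" | (one) "n = 1" "k = 1 \<or> k = - 1"
    | (mn) "n \<ge> 2" "k = - int n" | (neg) "n \<ge> 2" "- int n < k" "k < 0"
    | (k1) "n \<ge> 2" "k = 1" | (pos) "n \<ge> 2" "1 < k" "k \<le> int n"
    by linarith
  then show ?case
  proof cases
    case out
    then have "V n k = 0" by (subst V.simps) auto
    then show ?thesis using zero by simp
  next
    case one
    have "inverse t_var * t_var\<^sup>2 = t_var"
      using t0 by (simp add: power2_eq_square mult.assoc[symmetric])
    moreover have "t_var\<^sup>2 \<in> range to_fract"
      using mult[OF t_in t_in] by (simp add: power2_eq_square)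
    ultimately show ?thesis
      using one t_in V_1_1 V_1_m1 \<open>1 \<in> _\<close> by auto
  next
    case mn
    then show ?thesis using V_neg_n[of n] zero by auto
  next
    case neg
    have "V n k = V n (k - 1) + inverse t_var * V (n - 1) (- k)"
      using neg by (subst V.simps) auto
    then show ?thesis using neg 1(1,2) add by auto
  next
    case k1
    have eq: "V n k = t_var * (t_var * V n (- 1))"
      using k1 V_one[of n] by (simp add: power2_eq_square mult.assoc)
    have "t_var * V n (- 1) \<in> range to_fract"
      using k1 1(3) mult[OF t_in] by auto
    moreover have "inverse t_var * V n k = t_var * V n (- 1)"
      unfolding eq using t0 by (simp add: mult.assoc[symmetric])
    ultimately show ?thesis using mult[OF t_in] eq by metis
  next
    case pos
    have eq: "V n k = V n (k - 1) + t_var * V (n - 1) (- k + 1)"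
      using pos by (subst V.simps) auto
    have IH1: "V n (k - 1) \<in> range to_fract" "inverse t_var * V n (k - 1) \<in> range to_fract"
      using pos 1(4) by auto
    have IH2: "V (n - 1) (- k + 1) \<in> range to_fract"
      using pos 1(5) by auto
    have "inverse t_var * V n k = inverse t_var * V n (k - 1) + V (n - 1) (- k + 1)"
      unfolding eq using t0 by (simp add: distrib_left mult.assoc[symmetric])
    then show ?thesis using IH1 IH2 eq add mult[OF t_in] by metis
  qed
qed

lemma V_polynomial: "\<exists>p. V n k = to_fract p"
  using V_polynomial_aux[of n k] by blast

end

theory Submission
  imports Defs
begin

text \<open>
  Both sums telescope: the two difference recurrences for row \<open>n + 1\<close> of the triangle add up to
  \<open>\<Sum>k\<le>n. V n k = t * V (n + 1) (- 1)\<close> and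
  \<open>t * (\<Sum>k\<le>n. V n (- k)) = V (n + 1) (n + 1) - V (n + 1) 1\<close>. Since \<open>V (n + 1) 1 = t\<^sup>2 * V (n + 1) (- 1)\<close>,
  the theorem says precisely that \<open>V (n + 1) (- 1)\<close> is \<open>Q\<^sub>n\<close> and \<open>V (n + 1) (n + 1)\<close> is \<open>t * P\<^sub>n\<close>,
  that is, it identifies two boundary entries of each row.

  These are found by solving the recurrences for the whole triangle. Index the entries
  \<open>V n (- k)\<close> and \<open>V n k\<close> by \<open>i = n - k\<close> and \<open>j = k - 1\<close>, and view them as the coefficients of
  \<open>x^i y^j / (i! j!)\<close> in two exponential generating functions \<open>A\<close> and \<open>B\<close>. The recurrences
  become \<open>(\<partial>\<^sub>x - \<partial>\<^sub>y) A = B / t\<close> and \<open>(\<partial>\<^sub>x - \<partial>\<^sub>y) B = - t A\<close>, so \<open>A\<close> and \<open>B\<close> rotate along the lines on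
  which \<open>x + y\<close> is constant. With the boundary values \<open>A(0, y) = 1\<close> and \<open>B(x, 0) = t\<^sup>2 A(x, 0)\<close> and with
  \<open>t = tan \<theta>\<close> this forces
    \<open>A = cos x + tan (\<theta> + x + y) * sin x\<close> and \<open>B = t * (tan (\<theta> + x + y) * cos x - sin x)\<close>.
  Hence \<open>A(x, 0) = sec (\<theta> + x) / sec \<theta>\<close>, whose coefficients are the \<open>Q\<^sub>i(t)\<close>, and
  \<open>B(0, y) = t * tan (\<theta> + y)\<close>, whose coefficients are \<open>t * P\<^sub>j(t)\<close>.

  The derivatives at \<open>x = 0\<close> are taken algebraically. A pair of polynomials \<open>(p, q)\<close> stands for the function
  \<open>p(tan (\<theta> + x)) * cos x + q(tan (\<theta> + x)) * sin x\<close>; differentiation in \<open>x\<close> is the additive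
  operator \<open>trig_deriv\<close> on pairs, and the value at \<open>x = 0\<close> is the first component at \<open>t\<close>. The lemmas
  \<open>V_closed_form\<close>, \<open>trig_deriv_power_sec\<close> and \<open>trig_deriv_power_tan_sec\<close> carry the proof.
\<close>

section \<open>Recurrences for the derivative polynomials\<close>

lemma P_poly_0: "P_poly 0 = [:0, 1:]"
  by (rule P_poly_unique) simp

lemma Q_poly_0: "Q_poly 0 = 1"
  by (rule Q_poly_unique) simp

lemma P_poly_Suc: "P_poly (Suc n) = pderiv (P_poly n) * [:1, 0, 1:]"
proof (rule P_poly_unique)
  fix x :: real
  assume x: "cos x \<noteq> 0"
  have "deriv ((deriv ^^ n) tan) x = deriv (\<lambda>y. poly (P_poly n) (tan y)) x"
    by (intro deriv_cong_ev refl eventually_mono[OF eventually_cos_neq_0[OF x]]) (rule P_poly_tan)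
  also have "\<dots> = poly (pderiv (P_poly n)) (tan x) * (1 + (tan x)\<^sup>2)"
    by (intro DERIV_imp_deriv DERIV_chain2[OF poly_DERIV DERIV_tan_poly] x)
  finally show "(deriv ^^ Suc n) tan x = poly (pderiv (P_poly n) * [:1, 0, 1:]) (tan x)"
    by (simp add: power2_eq_square algebra_simps)
qed

lemma Q_poly_Suc: "Q_poly (Suc n) = pderiv (Q_poly n) * [:1, 0, 1:] + [:0, 1:] * Q_poly n"
proof (rule Q_poly_unique)
  fix x :: real
  assume x: "cos x \<noteq> 0"
  have "deriv ((deriv ^^ n) sec) x = deriv (\<lambda>y. poly (Q_poly n) (tan y) * sec y) x"
    by (intro deriv_cong_ev refl eventually_mono[OF eventually_cos_neq_0[OF x]]) (rule Q_poly_sec)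
  also have "\<dots> = poly (pderiv (Q_poly n)) (tan x) * (1 + (tan x)\<^sup>2) * sec x
                   + tan x * sec x * poly (Q_poly n) (tan x)"
    by (intro DERIV_imp_deriv DERIV_mult DERIV_chain2[OF poly_DERIV DERIV_tan_poly] DERIV_sec x)
  finally show "(deriv ^^ Suc n) sec x =
      poly (pderiv (Q_poly n) * [:1, 0, 1:] + [:0, 1:] * Q_poly n) (tan x) * sec x"
    by (simp add: power2_eq_square algebra_simps)
qed

section \<open>Differentiating combinations of cosine and sine\<close>

text \<open>
  If \<open>(p, q)\<close> stands for the function \<open>p(tan (\<theta> + x)) * cos x + q(tan (\<theta> + x)) * sin x\<close>, then
  this is its derivative in \<open>x\<close>: by the chain rule the coefficients are differentiated by
  \<open>(1 + t\<^sup>2) d/dt\<close>, while \<open>cos\<close> and \<open>sin\<close> are rotated.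
\<close>

definition trig_deriv :: "real poly \<times> real poly \<Rightarrow> real poly \<times> real poly" where
  "trig_deriv = (\<lambda>(p, q). (pderiv p * [:1, 0, 1:] + q, pderiv q * [:1, 0, 1:] - p))"

lemma trig_deriv_add: "trig_deriv (u + v) = trig_deriv u + trig_deriv v"
  by (cases u; cases v) (simp add: trig_deriv_def pderiv_add distrib_right)

lemma trig_deriv_diff: "trig_deriv (u - v) = trig_deriv u - trig_deriv v"
  by (cases u; cases v) (simp add: trig_deriv_def pderiv_diff left_diff_distrib)

lemma trig_deriv_power_add:
  "(trig_deriv ^^ i) (u + v) = (trig_deriv ^^ i) u + (trig_deriv ^^ i) v"
  by (induction i) (simp_all add: trig_deriv_add)

lemma trig_deriv_power_diff:
  "(trig_deriv ^^ i) (u - v) = (trig_deriv ^^ i) u - (trig_deriv ^^ i) v"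
  by (induction i) (simp_all add: trig_deriv_diff)

text \<open>
  The pair \<open>(1, t)\<close> stands for \<open>cos x + tan (\<theta> + x) * sin x = cos \<theta> * sec (\<theta> + x)\<close>, so its iterated
  derivatives have the form \<open>cos \<theta> * r(tan (\<theta> + x)) * sec (\<theta> + x)\<close>, which the pair \<open>(r, r t)\<close> represents.
\<close>

lemma trig_deriv_power_sec:
  "(trig_deriv ^^ i) (1, [:0, 1:]) = (Q_poly i, [:0, 1:] * Q_poly i)"
proof (induction i)
  case 0
  show ?case by (simp add: Q_poly_0)
next
  case (Suc i)
  have "trig_deriv (r, [:0, 1:] * r) =
      (pderiv r * [:1, 0, 1:] + [:0, 1:] * r, [:0, 1:] * (pderiv r * [:1, 0, 1:] + [:0, 1:] * r))"
    for r :: "real poly"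
    by (simp add: trig_deriv_def pderiv_mult pderiv_pCons algebra_simps)
  with Suc show ?case by (simp add: Q_poly_Suc)
qed

text \<open>
  Likewise \<open>(t, - 1)\<close> stands for \<open>tan (\<theta> + x) * cos x - sin x = sin \<theta> * sec (\<theta> + x)\<close>, which is the
  function above multiplied by the constant \<open>tan \<theta>\<close>.
\<close>

lemma trig_deriv_power_tan_sec:
  "(trig_deriv ^^ i) ([:0, 1:], - 1) = ([:0, 1:] * Q_poly i, - Q_poly i)"
proof (induction i)
  case 0
  show ?case by (simp add: Q_poly_0)
next
  case (Suc i)
  have "trig_deriv ([:0, 1:] * r, - r) =
      ([:0, 1:] * (pderiv r * [:1, 0, 1:] + [:0, 1:] * r),
       - (pderiv r * [:1, 0, 1:] + [:0, 1:] * r))"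
    for r :: "real poly"
    by (simp add: trig_deriv_def pderiv_mult pderiv_pCons pderiv_minus algebra_simps)
  with Suc show ?case by (simp add: Q_poly_Suc)
qed

section \<open>The triangle in closed form\<close>

text \<open>
  The mixed Taylor coefficients \<open>\<partial>\<^sub>x^i \<partial>\<^sub>y^j\<close> at the origin of \<open>cos x + tan (\<theta> + x + y) * sin x\<close> and
  \<open>tan (\<theta> + x + y) * cos x - sin x\<close>. The \<open>j\<close> derivatives in \<open>y\<close> turn \<open>tan\<close> into \<open>P\<^sub>j\<close> and, for
  \<open>j > 0\<close>, kill the other summand.
\<close>

definition cos_coeff :: "nat \<Rightarrow> nat \<Rightarrow> real poly" where
  "cos_coeff i j = fst ((trig_deriv ^^ i) (of_bool (j = 0), P_poly j))"

definition sin_coeff :: "nat \<Rightarrow> nat \<Rightarrow> real poly" where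
  "sin_coeff i j = fst ((trig_deriv ^^ i) (P_poly j, - of_bool (j = 0)))"

lemma cos_coeff_0: "cos_coeff 0 j = of_bool (j = 0)"
  by (simp add: cos_coeff_def)

lemma sin_coeff_0: "sin_coeff 0 j = P_poly j"
  by (simp add: sin_coeff_def)

lemma cos_coeff_sec: "cos_coeff i 0 = Q_poly i"
  by (simp add: cos_coeff_def P_poly_0 trig_deriv_power_sec)

lemma sin_coeff_tan_sec: "sin_coeff i 0 = [:0, 1:] * Q_poly i"
  by (simp add: sin_coeff_def P_poly_0 trig_deriv_power_tan_sec)

text \<open>
  In the next two lemmas the operator \<open>\<partial>\<^sub>x - \<partial>\<^sub>y\<close> annihilates \<open>tan (\<theta> + x + y)\<close> and so acts only on
  the factors \<open>cos x\<close> and \<open>sin x\<close>.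
\<close>

lemma cos_coeff_Suc: "cos_coeff (Suc i) j = cos_coeff i (Suc j) + sin_coeff i j"
proof -
  have "trig_deriv (of_bool (j = 0), P_poly j) =
      (of_bool (Suc j = 0), P_poly (Suc j)) + (P_poly j, - of_bool (j = 0))"
    by (simp add: trig_deriv_def P_poly_Suc)
  then show ?thesis
    by (simp only: cos_coeff_def sin_coeff_def funpow_Suc_right o_apply trig_deriv_power_add fst_add)
qed

lemma sin_coeff_Suc: "sin_coeff i (Suc j) = sin_coeff (Suc i) j + cos_coeff i j"
proof -
  have "trig_deriv (P_poly j, - of_bool (j = 0)) =
      (P_poly (Suc j), - of_bool (Suc j = 0)) - (of_bool (j = 0), P_poly j)"
    by (simp add: trig_deriv_def P_poly_Suc pderiv_minus)
  then show ?thesis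
    by (simp only: cos_coeff_def sin_coeff_def funpow_Suc_right o_apply trig_deriv_power_diff
        fst_diff diff_add_cancel)
qed

lemma t_var_nonzero: "t_var \<noteq> 0"
  by (simp add: t_var_def)

text \<open>
  Both families satisfy the recurrences and boundary conditions that define the triangle. The
  induction follows the order in which the triangle is filled in: row by row, and within
  a row from \<open>- n\<close> up to \<open>- 1\<close>, then from \<open>1\<close> up to \<open>n\<close>.
\<close>

lemma V_closed_form:
  "i + j = m \<Longrightarrow> V (Suc m) (- int (Suc j)) = to_fract (cos_coeff i j) \<and>
                 V (Suc m) (int (Suc j)) = t_var * to_fract (sin_coeff i j)"
proof (induction m arbitrary: i j)
  case 0
  then show ?case
    using V_1_1 V_1_m1
    by (simp add: cos_coeff_0 sin_coeff_0 P_poly_0 power2_eq_square flip: t_var_def)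
next
  case (Suc m)
  note previous_row = Suc.IH
  have neg: "V (Suc (Suc m)) (- int (Suc j)) = to_fract (cos_coeff i j)"
    if "i + j = Suc m" for i j
    using that
  proof (induction i arbitrary: j)
    case 0
    then show ?case using V_neg_n[of "Suc (Suc m)"] by (simp add: cos_coeff_0)
  next
    case (Suc i)
    have "V (Suc (Suc m)) (- int (Suc j)) =
        V (Suc (Suc m)) (- int (Suc (Suc j))) + inverse t_var * V (Suc m) (int (Suc j))"
      using V_neg[of "Suc j" "Suc (Suc m)"] Suc.prems by (simp add: algebra_simps)
    also have "\<dots> = to_fract (cos_coeff i (Suc j)) + to_fract (sin_coeff i j)"
      using Suc.IH[of "Suc j"] previous_row[of i j] Suc.prems t_var_nonzero
      by (simp add: mult.assoc[symmetric])
    finally show ?case by (simp add: cos_coeff_Suc)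
  qed
  have pos: "V (Suc (Suc m)) (int (Suc j)) = t_var * to_fract (sin_coeff i j)"
    if "i + j = Suc m" for i j
    using that
  proof (induction j arbitrary: i)
    case 0
    have "V (Suc (Suc m)) 1 = t_var\<^sup>2 * V (Suc (Suc m)) (- 1)"
      by (rule V_one) simp
    with neg[of i 0] 0 show ?case
      by (simp add: cos_coeff_sec sin_coeff_tan_sec t_var_def power2_eq_square
          del: mult_pCons_left flip: to_fract_mult)
  next
    case (Suc j)
    have "V (Suc (Suc m)) (int (Suc (Suc j))) =
        V (Suc (Suc m)) (int (Suc j)) + t_var * V (Suc m) (- int (Suc j))"
      using V_pos[of "Suc (Suc j)" "Suc (Suc m)"] Suc.prems by (simp add: algebra_simps)
    also have "\<dots> = t_var * (to_fract (sin_coeff (Suc i) j) + to_fract (cos_coeff i j))"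
      using Suc.IH[of "Suc i"] previous_row[of i j] Suc.prems
      by (simp add: distrib_left)
    finally show ?case by (simp add: sin_coeff_Suc)
  qed
  from neg pos Suc.prems show ?case by blast
qed

lemma V_minus_one: "V (Suc n) (- 1) = to_fract (Q_poly n)"
  using V_closed_form[of n 0 n] by (simp add: cos_coeff_sec)

lemma V_diagonal: "V (Suc n) (int (Suc n)) = t_var * to_fract (P_poly n)"
  using V_closed_form[of 0 n n] by (simp add: sin_coeff_0)

section \<open>Row sums\<close>

lemma sum_V_pos:
  "m \<le> n \<Longrightarrow> (\<Sum>k=1..m. V n (int k)) = t_var * (V (Suc n) (- 1) - V (Suc n) (- int (Suc m)))"
proof (induction m)
  case 0
  show ?case by simp
next
  case (Suc m)
  have "V (Suc n) (- int (Suc m)) =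
      V (Suc n) (- int (Suc (Suc m))) + inverse t_var * V n (int (Suc m))"
    using V_neg[of "Suc m" "Suc n"] Suc.prems by (simp add: algebra_simps)
  then have "V n (int (Suc m)) =
      t_var * (V (Suc n) (- int (Suc m)) - V (Suc n) (- int (Suc (Suc m))))"
    using t_var_nonzero by (simp add: mult.assoc[symmetric])
  then show ?case using Suc by (simp add: algebra_simps)
qed

lemma sum_V_neg:
  "m \<le> n \<Longrightarrow> t_var * (\<Sum>k=1..m. V n (- int k)) = V (Suc n) (int (Suc m)) - V (Suc n) 1"
proof (induction m)
  case 0
  show ?case by simp
next
  case (Suc m)
  have "V (Suc n) (int (Suc (Suc m))) =
      V (Suc n) (int (Suc m)) + t_var * V n (- int (Suc m))"
    using V_pos[of "Suc (Suc m)" "Suc n"] Suc.prems by (simp add: algebra_simps)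
  then show ?case using Suc by (simp add: algebra_simps)
qed

theorem theorem1p2:
  fixes n :: nat
  assumes "n \<ge> 1"
  shows "to_fract (Q_poly n) = (1 / t_var) * (\<Sum>k=1..n. V n (int k)) \<and>
         to_fract (P_poly n) - t_var * to_fract (Q_poly n) = (\<Sum>k=1..n. V n (- int k))"
proof
  have "V (Suc n) (- int (Suc n)) = 0"
    using V_neg_n[of "Suc n"] assms by simp
  then have "(\<Sum>k=1..n. V n (int k)) = t_var * to_fract (Q_poly n)"
    using sum_V_pos[of n n] by (simp add: V_minus_one)
  then show "to_fract (Q_poly n) = (1 / t_var) * (\<Sum>k=1..n. V n (int k))"
    using t_var_nonzero by simp
next
  have "V (Suc n) 1 = t_var\<^sup>2 * to_fract (Q_poly n)"
    using V_one[of "Suc n"] assms by (simp add: V_minus_one)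
  then have "t_var * (\<Sum>k=1..n. V n (- int k)) =
      t_var * (to_fract (P_poly n) - t_var * to_fract (Q_poly n))"
    using sum_V_neg[of n n, unfolded V_diagonal] by (simp add: power2_eq_square algebra_simps)
  then show "to_fract (P_poly n) - t_var * to_fract (Q_poly n) = (\<Sum>k=1..n. V n (- int k))"
    using t_var_nonzero by simp
qed

end
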